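(* Let $K$ be an arbitrary field, $m\geq 2$ and $\Gamma\in\mathbb{S}(m)$. For each algebra $A\in\mathcal{A}(m,\Gamma)$ there is a unique $K$-basis $\{1,f_\gamma\mid\gamma\in\Gamma\}$ of the algebra $\overline{A}=A/x^mK[x]$ that satisfies the condition that for every $\gamma\in\Gamma$ $$f_\gamma=x^\gamma+\sum_{\delta\in C\Gamma(\gamma)}\lambda_{\gamma\delta}x^\delta,\quad \lambda_{\gamma\delta}\in K,$$ where $C\Gamma(\gamma)=\{\delta\mid\delta\notin\Gamma,\ \gamma<\delta\leq m-1\}$.
   Context: $\mathbb{S}(m)$ is the set consisting of the empty set and of all non-empty subsets $\Gamma\subseteq\{2,\ldots,m-2\}$ such that $\Gamma+\Gamma\subseteq\Gamma\cup[m,\infty)$. $\mathcal{A}(m)$ is the set of all $K$-subalgebras $A$ of $K[x]$ such that $x^mK[x]\subset A$ and $x^{m-1}\notin A$. For $A\in\mathcal{A}(m)$, $\Gamma_A$ is the set of integers $\gamma$ with $1\leq\gamma\leq m-1$ such that $A$ contains an element of the form $x^\gamma+\sum_{j>\gamma}\lambda_jx^j$ with $\lambda_j\in K$; one has $\Gamma_A\in\mathbb{S}(m)$. $\mathcal{A}(m,\Gamma):=\{A\in\mathcal{A}(m)\mid\Gamma_A=\Gamma\}$. $\overline{A}:=A/x^mK[x]$ is a subalgebra of $F:=K[x]/x^mK[x]=\bigoplus_{i=0}^{m-1}Kx^i$. *)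

theory Defs
  imports "Jordan_Normal_Form.VS_Connect" "HOL-Algebra.QuotRing" "HOL-Algebra.Subrings"
begin

hide_const (open) up_ring.monom up_ring.coeff

text \<open>The set \<open>\<S>(m)\<close>. Truncated subtraction is harmless: for \<open>m < 4\<close> the interval
  \<open>{2..m - 2}\<close> is empty both here and for integer bounds.\<close>

definition gap_semigroups :: "nat \<Rightarrow> nat set set"
  where "gap_semigroups m = insert {}
    {\<Gamma>. \<Gamma> \<noteq> {} \<and> \<Gamma> \<subseteq> {2..m - 2} \<and> (\<forall>\<alpha>\<in>\<Gamma>. \<forall>\<beta>\<in>\<Gamma>. \<alpha> + \<beta> \<in> \<Gamma> \<union> {m..})}"

text \<open>\<open>K[x]\<close> is the type \<^typ>\<open>'k poly\<close>, viewed as a ring record by \<^const>\<open>class_ring\<close>.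
  Subalgebras are unital, since \<^const>\<open>subring\<close> requires the unit.\<close>

definition poly_subalgebra :: "'k::field poly set \<Rightarrow> bool"
  where "poly_subalgebra A \<longleftrightarrow> subring A class_ring \<and> (\<forall>c. \<forall>p\<in>A. Polynomial.smult c p \<in> A)"

definition xpow_ideal :: "nat \<Rightarrow> 'k::field poly set"
  where "xpow_ideal m = PIdl\<^bsub>class_ring\<^esub> (monom 1 m)"

definition cuspidal_algebras :: "nat \<Rightarrow> 'k::field poly set set"
  where "cuspidal_algebras m =
    {A. poly_subalgebra A \<and> xpow_ideal m \<subset> A \<and> monom 1 (m - 1) \<notin> A}"

text \<open>\<open>\<Gamma>\<^sub>A\<close>: a polynomial has the form \<open>x\<^sup>\<gamma> + \<Sum>\<^sub>j\<^sub>>\<^sub>\<gamma> \<lambda>\<^sub>j x\<^sup>j\<close> iff its coefficients below \<open>\<gamma>\<close> vanish and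
  the one at \<open>\<gamma>\<close> is \<open>1\<close>.\<close>

definition order_set :: "nat \<Rightarrow> 'k::field poly set \<Rightarrow> nat set"
  where "order_set m A = {\<gamma>. 1 \<le> \<gamma> \<and> \<gamma> \<le> m - 1 \<and>
    (\<exists>p\<in>A. coeff p \<gamma> = 1 \<and> (\<forall>j<\<gamma>. coeff p j = 0))}"

definition cuspidal_algebras_of :: "nat \<Rightarrow> nat set \<Rightarrow> 'k::field poly set set"
  where "cuspidal_algebras_of m \<Gamma> = {A \<in> cuspidal_algebras m. order_set m A = \<Gamma>}"

definition xcoset :: "nat \<Rightarrow> 'k::field poly \<Rightarrow> 'k poly set"
  where "xcoset m p = xpow_ideal m +>\<^bsub>class_ring\<^esub> p"

text \<open>The \<open>K\<close>-algebra \<open>F = K[x]/x\<^sup>mK[x]\<close>: the quotient ring together with the scalar action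
  \<open>c \<cdot> (p + x\<^sup>mK[x]) = cp + x\<^sup>mK[x]\<close>.\<close>

definition trunc_poly_algebra :: "nat \<Rightarrow> ('k::field, 'k poly set) module"
  where "trunc_poly_algebra m = ring.extend (class_ring Quot xpow_ideal m)
    (module.fields (\<lambda>c X. \<Union>p\<in>X. xcoset m (Polynomial.smult c p)))"

definition quotient_algebra :: "nat \<Rightarrow> 'k::field poly set \<Rightarrow> ('k, 'k poly set) module"
  where "quotient_algebra m A = trunc_poly_algebra m\<lparr>carrier := xcoset m ` A\<rparr>"

definition upper_gaps :: "nat \<Rightarrow> nat set \<Rightarrow> nat \<Rightarrow> nat set"
  where "upper_gaps m \<Gamma> \<gamma> = {\<delta>. \<delta> \<notin> \<Gamma> \<and> \<gamma> < \<delta> \<and> \<delta> \<le> m - 1}"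

lemma xcoset_mem: "r \<in> xcoset m p \<longleftrightarrow> monom 1 m dvd r - p" for r p :: "'k::field poly"
  unfolding xcoset_def xpow_ideal_def cgenideal_def a_r_coset_def r_coset_def dvd_def
  by simp (metis add_diff_cancel_right' diff_add_cancel mult.commute)

lemma xcoset_eq: "xcoset m p = xcoset m q \<longleftrightarrow> monom 1 m dvd p - q"
  for p q :: "'k::field poly"
proof
  assume "xcoset m p = xcoset m q"
  moreover have "p \<in> xcoset m p" by (simp add: xcoset_mem)
  ultimately show "monom 1 m dvd p - q" by (simp add: xcoset_mem)
next
  assume a: "monom 1 m dvd p - q"
  have "monom 1 m dvd r - p \<longleftrightarrow> monom 1 m dvd r - q" for r
    using dvd_add_left_iff[OF a, of "r - p"] by simp
  thus "xcoset m p = xcoset m q" by (auto simp: xcoset_mem)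
qed

lemma xpow_ideal: "ideal (xpow_ideal m :: 'k::field poly set) class_ring"
  unfolding xpow_ideal_def by (rule cring.cgenideal_ideal[OF class_cring.cring_axioms]) simp

lemma xcoset_add: "xcoset m p <+>\<^bsub>class_ring\<^esub> xcoset m q = xcoset m (p + q)"
  for p q :: "'k::field poly"
proof -
  interpret I: ideal "xpow_ideal m :: 'k poly set" class_ring by (rule xpow_ideal)
  show ?thesis unfolding xcoset_def using I.a_rcos_sum[of p q] by simp
qed

lemma xcoset_mult: "rcoset_mult class_ring (xpow_ideal m) (xcoset m p) (xcoset m q) = xcoset m (p * q)"
  for p q :: "'k::field poly"
proof -
  interpret I: ideal "xpow_ideal m :: 'k poly set" class_ring by (rule xpow_ideal)
  show ?thesis unfolding xcoset_def using I.rcoset_mult_add[of p q] by simp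
qed

lemma xcoset_smult: "(\<Union>r\<in>xcoset m p. xcoset m (Polynomial.smult c r)) = xcoset m (Polynomial.smult c p)"
  for p :: "'k::field poly"
proof -
  have "xcoset m (Polynomial.smult c r) = xcoset m (Polynomial.smult c p)" if "r \<in> xcoset m p" for r
    using that by (simp add: xcoset_mem xcoset_eq dvd_smult flip: smult_diff_right)
  moreover have "p \<in> xcoset m p" by (simp add: xcoset_mem)
  ultimately show ?thesis by blast
qed

lemma xcoset_zero: "xpow_ideal m = xcoset m (0 :: 'k::field poly)"
  unfolding xcoset_def a_r_coset_def r_coset_def by simp

lemma quotient_algebra_simps:
  fixes A :: "'k::field poly set"
  shows "carrier (quotient_algebra m A) = xcoset m ` A"
    "xcoset m p \<oplus>\<^bsub>quotient_algebra m A\<^esub> xcoset m q = xcoset m (p + q)"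
    "xcoset m p \<otimes>\<^bsub>quotient_algebra m A\<^esub> xcoset m q = xcoset m (p * q)"
    "\<one>\<^bsub>quotient_algebra m A\<^esub> = xcoset m 1"
    "\<zero>\<^bsub>quotient_algebra m A\<^esub> = xcoset m 0"
    "c \<odot>\<^bsub>quotient_algebra m A\<^esub> xcoset m p = xcoset m (Polynomial.smult c p)"
  by (simp_all add: quotient_algebra_def trunc_poly_algebra_def FactRing_def ring.defs module.defs
      xcoset_add xcoset_mult xcoset_smult flip: xcoset_zero)
     (simp add: xcoset_def)

lemma quotient_algebra_algebra:
  fixes A :: "'k::field poly set"
  assumes "poly_subalgebra A"
  shows "algebra class_ring (quotient_algebra m A)"
proof -
  have A: "0 \<in> A" "1 \<in> A" "\<And>p q. p \<in> A \<Longrightarrow> q \<in> A \<Longrightarrow> p + q \<in> A"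
    "\<And>p q. p \<in> A \<Longrightarrow> q \<in> A \<Longrightarrow> p * q \<in> A" "\<And>c p. p \<in> A \<Longrightarrow> Polynomial.smult c p \<in> A"
    using assms subringE[of A class_ring] by (auto simp: poly_subalgebra_def)
  have neg: "- p \<in> A" if "p \<in> A" for p
    using A(5)[OF that, of "-1"] by simp
  have ab: "abelian_group (quotient_algebra m A)"
    by (rule abelian_groupI)
       (auto simp: quotient_algebra_simps A ac_simps intro!: bexI[OF _ neg] imageI)
  have cm: "comm_monoid (quotient_algebra m A)"
    by (rule comm_monoidI) (auto simp: quotient_algebra_simps A ac_simps)
  have cr: "cring (quotient_algebra m A)"
    by (rule cringI[OF ab cm]) (auto simp: quotient_algebra_simps A algebra_simps)
  show ?thesis
    by (rule algebraI[OF class_cring.cring_axioms cr])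
       (auto simp: quotient_algebra_simps A smult_add_left smult_add_right)
qed

lemma quotient_algebra_vectorspace:
  fixes A :: "'k::field poly set"
  assumes "poly_subalgebra A"
  shows "vectorspace class_ring (quotient_algebra m A)"
  using quotient_algebra_algebra[OF assms, of m]
  unfolding vectorspace_def algebra_def using class_field by blast

end

theory Submission
  imports Defs
begin

text \<open>Every element of \<open>A\<close> with non-zero image in \<open>F\<close> has order in \<open>\<Gamma>\<^sub>A \<union> {0}\<close>, so an element of the
  quotient is determined by its coefficients at \<open>\<Gamma>\<^sub>A \<union> {0}\<close>. The basis is the one dual to these
  coefficient functionals; it exists by Gaussian elimination from the top order downwards.\<close>

lemma poly_subalgebra_closed:
  fixes A :: "'k::field poly set"
  assumes "poly_subalgebra A"
  shows "0 \<in> A" "1 \<in> A" "p \<in> A \<Longrightarrow> q \<in> A \<Longrightarrow> p + q \<in> A"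
    "p \<in> A \<Longrightarrow> Polynomial.smult c p \<in> A" "p \<in> A \<Longrightarrow> q \<in> A \<Longrightarrow> p - q \<in> A"
proof -
  show "0 \<in> A" "1 \<in> A" and add: "\<And>p q. p \<in> A \<Longrightarrow> q \<in> A \<Longrightarrow> p + q \<in> A"
    and smult: "\<And>c p. p \<in> A \<Longrightarrow> Polynomial.smult c p \<in> A"
    using assms subringE[of A class_ring] by (auto simp: poly_subalgebra_def)
  show "p - q \<in> A" if "p \<in> A" "q \<in> A" for p q
    using add[OF that(1) smult[OF that(2), of "-1"]] by simp
qed

lemma poly_subalgebra_sum:
  fixes A :: "'k::field poly set"
  assumes "poly_subalgebra A" "\<And>s. s \<in> S \<Longrightarrow> g s \<in> A"
  shows "(\<Sum>s\<in>S. g s) \<in> A"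
  using assms(2)
  by (induction S rule: infinite_finite_induct) (auto simp: poly_subalgebra_closed[OF assms(1)])

lemma finite_order_set: "finite (order_set m A)"
  by (rule finite_subset[of _ "{1..m - 1}"]) (auto simp: order_set_def)

text \<open>If \<open>p\<close> had a non-zero coefficient below \<open>m\<close>, its lowest
  exponent would be 0 or, after scaling that coefficient to 1 inside \<open>A\<close>, an element of
  \<open>order_set m A\<close>. Either case contradicts the vanishing.\<close>

lemma dvd_if_coeffs_vanish_on_orders:
  fixes A :: "'k::field poly set"
  assumes A: "poly_subalgebra A" and p: "p \<in> A"
    and van: "\<And>\<gamma>. \<gamma> \<in> insert 0 (order_set m A) \<Longrightarrow> coeff p \<gamma> = 0"
  shows "monom 1 m dvd p"
proof (rule ccontr)
  assume "\<not> monom 1 m dvd p"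
  then obtain k where k: "k < m" "coeff p k \<noteq> 0"
    by (auto simp: monom_1_dvd_iff')
  define n where "n = (LEAST k. coeff p k \<noteq> 0)"
  have n: "coeff p n \<noteq> 0" "n \<le> k" and below: "\<And>j. j < n \<Longrightarrow> coeff p j = 0"
    using k(2) LeastI[of "\<lambda>k. coeff p k \<noteq> 0"] Least_le[of "\<lambda>k. coeff p k \<noteq> 0"]
      not_less_Least[of _ "\<lambda>k. coeff p k \<noteq> 0"]
    unfolding n_def by blast+
  have "n \<noteq> 0" using n(1) van[of 0] by (intro notI) simp
  moreover have "Polynomial.smult (inverse (coeff p n)) p \<in> A"
    by (rule poly_subalgebra_closed(4)[OF A p])
  ultimately have "n \<in> order_set m A"
    using n below k(1) unfolding order_set_def
    by (auto intro!: bexI[of _ "Polynomial.smult (inverse (coeff p n)) p"])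
  with n(1) van show False by blast
qed

lemma xcoset_eq_if_coeffs_eq_on_orders:
  fixes A :: "'k::field poly set"
  assumes "poly_subalgebra A" "p \<in> A" "q \<in> A"
    and "\<And>\<gamma>. \<gamma> \<in> insert 0 (order_set m A) \<Longrightarrow> coeff p \<gamma> = coeff q \<gamma>"
  shows "xcoset m p = xcoset m q"
  unfolding xcoset_eq
  by (rule dvd_if_coeffs_vanish_on_orders[OF assms(1)])
     (use assms in \<open>simp_all add: poly_subalgebra_closed(5)\<close>)

lemma xcoset_eqD:
  fixes p q :: "'k::field poly"
  assumes "xcoset m p = xcoset m q" "j < m"
  shows "coeff p j = coeff q j"
  using assms by (simp add: xcoset_eq monom_1_dvd_iff')

text \<open>\<open>A\<close> contains the ideal, so it is a union of cosets. For uniqueness, this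
  puts a polynomial of the prescribed shape into \<open>A\<close> when only its coset is known to
  lie in the quotient.\<close>

lemma mem_if_xcoset_mem:
  fixes A :: "'k::field poly set"
  assumes A: "poly_subalgebra A" and "xpow_ideal m \<subseteq> A" and "xcoset m p \<in> xcoset m ` A"
  shows "p \<in> A"
proof -
  from assms(3) obtain q where q: "q \<in> A" "monom 1 m dvd p - q"
    by (auto simp: xcoset_eq)
  have "p - q \<in> A"
    using q(2) assms(2) by (auto simp: xcoset_zero xcoset_mem)
  from poly_subalgebra_closed(3)[OF A this q(1)] show ?thesis by simp
qed

text \<open>Downward elimination: start from an element of order \<gamma> and cancel its
  coefficients at larger orders. The vanishing below \<gamma> is part of the claim because it keeps
  later corrections from disturbing lower coefficients.\<close>

lemma ex_order_dual:
  fixes A :: "'k::field poly set"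
  assumes A: "poly_subalgebra A" and "\<gamma> \<in> order_set m A"
  shows "\<exists>p\<in>A. (\<forall>j<\<gamma>. coeff p j = 0) \<and>
    (\<forall>\<delta>\<in>order_set m A. coeff p \<delta> = (if \<delta> = \<gamma> then 1 else 0))"
  using assms(2)
proof (induction "m - \<gamma>" arbitrary: \<gamma> rule: less_induct)
  case less
  define S where "S = {\<beta> \<in> order_set m A. \<gamma> < \<beta>}"
  have S: "finite S" unfolding S_def using finite_order_set[of m A] by simp
  have "\<exists>p\<in>A. (\<forall>j<\<beta>. coeff p j = 0) \<and>
      (\<forall>\<delta>\<in>order_set m A. coeff p \<delta> = (if \<delta> = \<beta> then 1 else 0))" if "\<beta> \<in> S" for \<beta>
    using that less.prems by (intro less.hyps) (auto simp: S_def order_set_def)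
  then obtain g where g: "\<And>\<beta>. \<beta> \<in> S \<Longrightarrow> g \<beta> \<in> A" "\<And>\<beta> j. \<beta> \<in> S \<Longrightarrow> j < \<beta> \<Longrightarrow> coeff (g \<beta>) j = 0"
    "\<And>\<beta> \<delta>. \<beta> \<in> S \<Longrightarrow> \<delta> \<in> order_set m A \<Longrightarrow> coeff (g \<beta>) \<delta> = (if \<delta> = \<beta> then 1 else 0)"
    by metis
  obtain q where q: "q \<in> A" "coeff q \<gamma> = 1" "\<And>j. j < \<gamma> \<Longrightarrow> coeff q j = 0"
    using less.prems by (auto simp: order_set_def)
  \<comment> \<open>The \<open>g \<beta>\<close> are already dual to each other on the orders above
    \<gamma>, so one subtraction with the coefficients of \<open>q\<close> itself clears all of
    these orders at once.\<close>
  define p where "p = q - (\<Sum>\<beta>\<in>S. Polynomial.smult (coeff q \<beta>) (g \<beta>))"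
  have "p \<in> A"
    unfolding p_def using g(1) q(1)
    by (intro poly_subalgebra_closed[OF A] poly_subalgebra_sum[OF A])
  moreover have "coeff p j = coeff q j" if "j \<le> \<gamma>" for j
    using that g(2) by (auto simp: p_def coeff_sum S_def intro!: sum.neutral)
  moreover have "coeff p \<delta> = 0" if \<delta>: "\<delta> \<in> order_set m A" "\<gamma> < \<delta>" for \<delta>
  proof -
    have "(\<Sum>\<beta>\<in>S. coeff q \<beta> * coeff (g \<beta>) \<delta>) = (\<Sum>\<beta>\<in>S. if \<delta> = \<beta> then coeff q \<beta> else 0)"
      using g(3) \<delta>(1) by (intro sum.cong) auto
    also have "\<dots> = coeff q \<delta>" using S \<delta> by (simp add: S_def)
    finally show ?thesis by (simp add: p_def coeff_sum)
  qed
  ultimately show ?case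
    using q(2,3) by (intro bexI[of _ p]) (auto, metis linorder_neqE_nat order.strict_implies_order)
qed

text \<open>Computes combinations on representatives. The coefficients \<open>a\<close> are indexed
  by vectors, and injectivity permits summing over the indices \<open>S\<close> instead.\<close>

lemma lincomb_xcoset:
  fixes A :: "'k::field poly set"
  assumes A: "poly_subalgebra A" and S: "finite S" "\<And>s. s \<in> S \<Longrightarrow> g s \<in> A"
    and inj: "inj_on (\<lambda>s. xcoset m (g s)) S"
  shows "module.lincomb (quotient_algebra m A) a ((\<lambda>s. xcoset m (g s)) ` S)
    = xcoset m (\<Sum>s\<in>S. Polynomial.smult (a (xcoset m (g s))) (g s))"
proof -
  interpret V: vectorspace class_ring "quotient_algebra m A"
    by (rule quotient_algebra_vectorspace[OF A])
  have *: "finsum (quotient_algebra m A) (\<lambda>s. xcoset m (h s)) S = xcoset m (\<Sum>s\<in>S. h s)"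
    if "\<And>s. s \<in> S \<Longrightarrow> h s \<in> A" for h
    using S(1) that
  proof (induction S rule: finite_induct)
    case empty
    then show ?case by (simp add: quotient_algebra_simps)
  next
    case (insert s S)
    then show ?case
      by (subst V.finsum_insert) (auto simp: quotient_algebra_simps)
  qed
  have "module.lincomb (quotient_algebra m A) a ((\<lambda>s. xcoset m (g s)) ` S)
    = finsum (quotient_algebra m A)
        (\<lambda>s. a (xcoset m (g s)) \<odot>\<^bsub>quotient_algebra m A\<^esub> xcoset m (g s)) S"
    unfolding V.lincomb_def using S(2) inj
    by (intro V.finsum_reindex)
       (auto simp: quotient_algebra_simps intro!: imageI poly_subalgebra_closed[OF A])
  also have "\<dots> = xcoset m (\<Sum>s\<in>S. Polynomial.smult (a (xcoset m (g s))) (g s))"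
    using S(2) by (simp add: quotient_algebra_simps * poly_subalgebra_closed[OF A])
  finally show ?thesis .
qed

text \<open>The coefficient of a combination at \<open>t\<close> is its scalar at \<open>t\<close>,
  and it depends only on the coset because \<open>t < m\<close>: this gives independence. For
  spanning, the combination with the coefficients of \<open>p\<close> as scalars agrees with
  \<open>p\<close> on \<open>S\<close>, so \<open>sep\<close> identifies the two cosets.\<close>

lemma basis_if_coeff_dual:
  fixes A :: "'k::field poly set"
  assumes A: "poly_subalgebra A" and S: "S \<subseteq> {..<m}" and g: "\<And>s. s \<in> S \<Longrightarrow> g s \<in> A"
    and dual: "\<And>s t. s \<in> S \<Longrightarrow> t \<in> S \<Longrightarrow> coeff (g s) t = (if t = s then 1 else 0)"
    and sep: "\<And>p q. p \<in> A \<Longrightarrow> q \<in> A \<Longrightarrow> (\<And>s. s \<in> S \<Longrightarrow> coeff p s = coeff q s) \<Longrightarrow>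
      xcoset m p = xcoset m q"
  shows "vectorspace.basis class_ring (quotient_algebra m A) ((\<lambda>s. xcoset m (g s)) ` S)"
proof -
  interpret V: vectorspace class_ring "quotient_algebra m A"
    by (rule quotient_algebra_vectorspace[OF A])
  let ?B = "(\<lambda>s. xcoset m (g s)) ` S"
  have fin: "finite S" using S by (rule finite_subset) simp
  have inj: "inj_on (\<lambda>s. xcoset m (g s)) S"
  proof (rule inj_onI)
    fix s t assume st: "s \<in> S" "t \<in> S" "xcoset m (g s) = xcoset m (g t)"
    then have "coeff (g s) s = coeff (g t) s" using S by (intro xcoset_eqD) auto
    with st(1,2) show "s = t" by (simp add: dual split: if_splits)
  qed
  note lincomb = lincomb_xcoset[OF A fin g inj]
  have coeff: "coeff (\<Sum>s\<in>S. Polynomial.smult (c s) (g s)) t = c t" if "t \<in> S" for c t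
  proof -
    have "(\<Sum>s\<in>S. c s * coeff (g s) t) = (\<Sum>s\<in>S. if t = s then c s else 0)"
      using that by (intro sum.cong) (auto simp: dual)
    then show ?thesis using fin that by (simp add: coeff_sum)
  qed
  have B: "?B \<subseteq> carrier (quotient_algebra m A)" "finite ?B"
    using g fin by (auto simp: quotient_algebra_simps)
  have "V.lin_indpt ?B"
  proof (rule V.finite_lin_indpt2[OF B(2,1)])
    fix a assume "V.lincomb a ?B = \<zero>\<^bsub>quotient_algebra m A\<^esub>"
    then have eq: "xcoset m (\<Sum>s\<in>S. Polynomial.smult (a (xcoset m (g s))) (g s)) = xcoset m 0"
      by (simp add: lincomb quotient_algebra_simps)
    have "a (xcoset m (g t)) = 0" if "t \<in> S" for t
      using xcoset_eqD[OF eq, of t] that S by (auto simp: coeff)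
    then show "\<forall>v\<in>?B. a v = \<zero>\<^bsub>class_ring\<^esub>" by simp
  qed
  moreover have "V.gen_set ?B"
  proof
    show "V.span ?B \<subseteq> carrier (quotient_algebra m A)"
      by (rule V.span_is_subset2[OF B(1)])
    show "carrier (quotient_algebra m A) \<subseteq> V.span ?B"
    proof
      fix v assume "v \<in> carrier (quotient_algebra m A)"
      then obtain p where p: "p \<in> A" "v = xcoset m p"
        by (auto simp: quotient_algebra_simps)
      \<comment> \<open>Scalars must be a function of the basis vector, so the index is recovered
        from the coset before the coefficient of \<open>p\<close> is read off.\<close>
      define a where "a v = coeff p (the_inv_into S (\<lambda>s. xcoset m (g s)) v)" for v
      have a: "a (xcoset m (g s)) = coeff p s" if "s \<in> S" for s
        using the_inv_into_f_f[OF inj that] by (simp add: a_def)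
      have "V.lincomb a ?B = xcoset m (\<Sum>s\<in>S. Polynomial.smult (coeff p s) (g s))"
        by (simp add: lincomb a)
      also have "\<dots> = v"
        unfolding p(2)
        by (intro sep poly_subalgebra_sum[OF A] poly_subalgebra_closed(4)[OF A] g p(1))
           (simp_all add: coeff)
      finally show "v \<in> V.span ?B"
        unfolding V.finite_span[OF B(2,1)] by auto
    qed
  qed
  ultimately show ?thesis
    unfolding V.basis_def using B(1) by simp
qed

lemma coeff_gap_polynomial:
  "coeff (monom 1 \<gamma> + (\<Sum>\<delta>\<in>upper_gaps m \<Gamma> \<gamma>. monom (c \<delta>) \<delta>)) j
    = (if j = \<gamma> then 1 else if j \<in> upper_gaps m \<Gamma> \<gamma> then c j else 0)"
proof -
  have "finite (upper_gaps m \<Gamma> \<gamma>)"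
    by (rule finite_subset[of _ "{..m - 1}"]) (auto simp: upper_gaps_def)
  then show ?thesis
    by (auto simp: coeff_sum upper_gaps_def)
qed

theorem proposition2p1:
  fixes m :: nat and \<Gamma> :: "nat set" and A :: "'k::field poly set"
  assumes "m \<ge> 2"
    and "\<Gamma> \<in> gap_semigroups m"
    and "A \<in> cuspidal_algebras_of m \<Gamma>"
  shows "\<exists>!f. f \<in> \<Gamma> \<rightarrow>\<^sub>E carrier (quotient_algebra m A) \<and>
    vectorspace.basis class_ring (quotient_algebra m A)
      (insert \<one>\<^bsub>quotient_algebra m A\<^esub> (f ` \<Gamma>)) \<and>
    (\<forall>\<gamma>\<in>\<Gamma>. \<exists>c :: nat \<Rightarrow> 'k.
      f \<gamma> = xcoset m (monom 1 \<gamma> + (\<Sum>\<delta>\<in>upper_gaps m \<Gamma> \<gamma>. monom (c \<delta>) \<delta>)))"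
    (is "\<exists>!f. ?P f")
proof -
  have A: "poly_subalgebra A" and sub: "xpow_ideal m \<subseteq> A" and \<Gamma>: "order_set m A = \<Gamma>"
    using assms(3) by (auto simp: cuspidal_algebras_of_def cuspidal_algebras_def)
  have range: "\<And>\<gamma>. \<gamma> \<in> \<Gamma> \<Longrightarrow> 0 < \<gamma> \<and> \<gamma> < m"
    using assms(1) by (auto simp: order_set_def simp flip: \<Gamma>)
  have zero: "0 \<notin> \<Gamma>" using range[of 0] by auto
  have sep: "xcoset m p = xcoset m q"
    if "p \<in> A" "q \<in> A" "\<And>\<gamma>. \<gamma> \<in> insert 0 \<Gamma> \<Longrightarrow> coeff p \<gamma> = coeff q \<gamma>" for p q
    by (rule xcoset_eq_if_coeffs_eq_on_orders[OF A]) (use that in \<open>auto simp: \<Gamma>\<close>)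
  have "\<forall>\<gamma>\<in>\<Gamma>. \<exists>p. p \<in> A \<and> (\<forall>j<\<gamma>. coeff p j = 0) \<and>
      (\<forall>\<delta>\<in>\<Gamma>. coeff p \<delta> = (if \<delta> = \<gamma> then 1 else 0))"
    using ex_order_dual[OF A, of _ m] unfolding \<Gamma> by blast
  from bchoice[OF this] obtain g where "\<forall>\<gamma>\<in>\<Gamma>. g \<gamma> \<in> A \<and> (\<forall>j<\<gamma>. coeff (g \<gamma>) j = 0) \<and>
      (\<forall>\<delta>\<in>\<Gamma>. coeff (g \<gamma>) \<delta> = (if \<delta> = \<gamma> then 1 else 0))"
    by blast
  then have g: "\<And>\<gamma>. \<gamma> \<in> \<Gamma> \<Longrightarrow> g \<gamma> \<in> A" "\<And>\<gamma> j. \<gamma> \<in> \<Gamma> \<Longrightarrow> j < \<gamma> \<Longrightarrow> coeff (g \<gamma>) j = 0"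
    "\<And>\<gamma> \<delta>. \<gamma> \<in> \<Gamma> \<Longrightarrow> \<delta> \<in> \<Gamma> \<Longrightarrow> coeff (g \<gamma>) \<delta> = (if \<delta> = \<gamma> then 1 else 0)"
    by blast+
  \<comment> \<open>The restriction to \<Gamma> fixes the values elsewhere, so that uniqueness holds
    as equality of functions.\<close>
  define f where "f = (\<lambda>\<gamma>\<in>\<Gamma>. xcoset m (g \<gamma>))"
  show ?thesis
  proof (rule ex1I)
    \<comment> \<open>The unit is the basis element at index 0. Duality extends to this index: each
      \<open>g \<gamma>\<close> has constant term 0 since \<gamma> is positive, and 1 has no higher
      coefficients.\<close>
    have "vectorspace.basis class_ring (quotient_algebra m A)
      ((\<lambda>\<gamma>. xcoset m ((g(0 := 1)) \<gamma>)) ` insert 0 \<Gamma>)"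
    proof (rule basis_if_coeff_dual[OF A])
      show "insert 0 \<Gamma> \<subseteq> {..<m}" using range assms(1) by auto
      show "(g(0 := 1)) s \<in> A" if "s \<in> insert 0 \<Gamma>" for s
        using that g(1) poly_subalgebra_closed(2)[OF A] by auto
      show "coeff ((g(0 := 1)) s) t = (if t = s then 1 else 0)"
        if "s \<in> insert 0 \<Gamma>" "t \<in> insert 0 \<Gamma>" for s t
        using that g(2,3) range by auto
    qed (rule sep)
    also have "(\<lambda>\<gamma>. xcoset m ((g(0 := 1)) \<gamma>)) ` insert 0 \<Gamma>
        = insert \<one>\<^bsub>quotient_algebra m A\<^esub> (f ` \<Gamma>)"
    proof -
      have "(\<lambda>\<gamma>. xcoset m ((g(0 := 1)) \<gamma>)) ` \<Gamma> = f ` \<Gamma>"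
        using zero by (intro image_cong) (auto simp: f_def)
      then show ?thesis by (simp add: quotient_algebra_simps)
    qed
    finally have "vectorspace.basis class_ring (quotient_algebra m A)
        (insert \<one>\<^bsub>quotient_algebra m A\<^esub> (f ` \<Gamma>))" .
    \<comment> \<open>Below \<open>m\<close>, the dual conditions leave \<open>g \<gamma>\<close>
      free only at the upper gaps, so its own coefficients there serve as the scalars. Terms of
      degree at least \<open>m\<close> disappear in the coset.\<close>
    moreover have "f \<gamma> = xcoset m
        (monom 1 \<gamma> + (\<Sum>\<delta>\<in>upper_gaps m \<Gamma> \<gamma>. monom (coeff (g \<gamma>) \<delta>) \<delta>))" if "\<gamma> \<in> \<Gamma>" for \<gamma>
    proof -
      have "coeff (g \<gamma>) j
          = coeff (monom 1 \<gamma> + (\<Sum>\<delta>\<in>upper_gaps m \<Gamma> \<gamma>. monom (coeff (g \<gamma>) \<delta>) \<delta>)) j"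
        if "j < m" for j
        unfolding coeff_gap_polynomial
        using that \<open>\<gamma> \<in> \<Gamma>\<close> g(2)[of \<gamma> j] g(3)[of \<gamma> j] g(3)[of \<gamma> \<gamma>]
        by (cases "j < \<gamma>") (auto simp: upper_gaps_def)
      then show ?thesis
        using that by (simp add: f_def xcoset_eq monom_1_dvd_iff')
    qed
    ultimately show "?P f"
      using g(1) by (auto simp: f_def quotient_algebra_simps)
  next
    fix f' assume f': "?P f'"
    show "f' = f"
    proof (rule PiE_ext)
      show "f' \<in> \<Gamma> \<rightarrow>\<^sub>E carrier (quotient_algebra m A)" using f' by blast
      show "f \<in> \<Gamma> \<rightarrow>\<^sub>E carrier (quotient_algebra m A)"
        using g(1) by (auto simp: f_def quotient_algebra_simps)
      fix \<gamma> assume \<gamma>: "\<gamma> \<in> \<Gamma>"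
      obtain c :: "nat \<Rightarrow> 'k" where
        c: "f' \<gamma> = xcoset m (monom 1 \<gamma> + (\<Sum>\<delta>\<in>upper_gaps m \<Gamma> \<gamma>. monom (c \<delta>) \<delta>))"
          (is "_ = xcoset m ?p")
        using f' \<gamma> by blast
      have "xcoset m ?p \<in> xcoset m ` A"
        using f' \<gamma> unfolding c[symmetric] quotient_algebra_simps(1)[symmetric] by blast
      then have "?p \<in> A" by (rule mem_if_xcoset_mem[OF A sub])
      \<comment> \<open>The upper gaps avoid \<Gamma> and exceed \<gamma>, so the prescribed shape
        forces coefficient 1 at \<gamma> and 0 elsewhere on \<open>insert 0 \<Gamma>\<close>. These
        are the coefficients of \<open>g \<gamma>\<close>, and they determine the coset of an
        element of \<open>A\<close>.\<close>
      then have "xcoset m ?p = xcoset m (g \<gamma>)"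
      proof (rule sep)
        show "g \<gamma> \<in> A" by (rule g(1)[OF \<gamma>])
        show "coeff ?p \<delta> = coeff (g \<gamma>) \<delta>" if "\<delta> \<in> insert 0 \<Gamma>" for \<delta>
          using that \<gamma> g(2,3) range unfolding coeff_gap_polynomial
          by (auto simp: upper_gaps_def)
      qed
      then show "f' \<gamma> = f \<gamma>" using \<gamma> by (simp add: c f_def)
    qed
  qed
qed

end
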